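(* Let $(R,\mathfrak{m},K)$ be a local Artinian commutative ring that is Frobenius, let $n\ge 1$, and let $C\subseteq R^n$ be an LCD $R$-code. Then $C$ is a free $R$-code.
   Context: All rings are commutative with unity. $(R,\mathfrak{m},K)$ is a local Artinian ring with maximal ideal $\mathfrak{m}$ and residue field $K=R/\mathfrak{m}$. $R$ is Frobenius if $\operatorname{soc}(R)=\{r\in R:\mathfrak{m}r=0\}\cong K$. An $R$-code of length $n$ is an $R$-submodule $C\subseteq R^n$; it is a free $R$-code if it is a free $R$-module. The orthogonal code is $C^\perp=\{v\in R^n : v\cdot w=0 \text{ for all } w\in C\}$, where $v\cdot w=v_1w_1+\cdots+v_nw_n$. The code $C$ is linear complementary dual (LCD) if its hull $C\cap C^\perp$ is $0$. *)

theory Defs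
  imports "HOL-Analysis.Analysis" "HOL-Library.Set_Algebras"
begin

lemma module_self: "module ((*) :: 'a::comm_ring_1 \<Rightarrow> 'a \<Rightarrow> 'a)"
  by unfold_locales (simp_all add: algebra_simps)

lemma module_vec: "module ((*s) :: 'a::comm_ring_1 \<Rightarrow> 'a^'n \<Rightarrow> 'a^'n)"
  by unfold_locales (simp_all add: vec_eq_iff algebra_simps)

text \<open>The ring is the whole of a type of class \<^class>\<open>comm_ring_1\<close>.\<close>

definition is_ideal :: "'a::comm_ring_1 set \<Rightarrow> bool" where
  "is_ideal I \<longleftrightarrow> module.subspace (*) I"

definition is_maximal_ideal :: "'a::comm_ring_1 set \<Rightarrow> bool" where
  "is_maximal_ideal M \<longleftrightarrow> is_ideal M \<and> M \<noteq> UNIV \<and>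
     (\<forall>J. is_ideal J \<and> M \<subseteq> J \<and> J \<noteq> UNIV \<longrightarrow> J = M)"

definition is_local_ring :: "'a::comm_ring_1 set \<Rightarrow> bool" where
  "is_local_ring M \<longleftrightarrow> is_maximal_ideal M \<and> (\<forall>J. is_maximal_ideal J \<longrightarrow> J = M)"

definition is_artinian :: "'a::comm_ring_1 itself \<Rightarrow> bool" where
  "is_artinian (_ :: 'a itself) \<longleftrightarrow>
     (\<forall>I :: nat \<Rightarrow> 'a set. (\<forall>k. is_ideal (I k)) \<and> decseq I \<longrightarrow>
        (\<exists>N. \<forall>k\<ge>N. I k = I N))"

text \<open>
  The quotient of the ring by an ideal consists of the cosets \<open>a +o M\<close>.  Its addition is the
  elementwise sum of sets, and the ring acts by \<open>scale_coset\<close>; the two lemmas below show that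
  these are the usual quotient operations.  The plain product set \<open>r *o A\<close> would be too small:
  it is in general not a coset.
\<close>

definition quotient_by :: "'a::comm_ring_1 set \<Rightarrow> 'a set set" where
  "quotient_by M = range (\<lambda>a. a +o M)"

definition scale_coset :: "'a::comm_ring_1 set \<Rightarrow> 'a \<Rightarrow> 'a set \<Rightarrow> 'a set" where
  "scale_coset M r A = (\<Union>a\<in>A. (r * a) +o M)"

lemma coset_add:
  fixes M :: "'a::comm_ring_1 set"
  assumes "is_ideal M"
  shows "(a +o M) + (b +o M) = (a + b) +o M"
proof -
  have s: "module.subspace (*) M" using assms by (simp add: is_ideal_def)
  have "M + M = M"
    using module.subspace_0[OF module_self s] module.subspace_add[OF module_self s]
    by (auto simp: set_plus_def) (metis add.right_neutral)
  then show ?thesis by (simp add: set_plus_rearrange)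
qed

lemma scale_coset_coset:
  fixes M :: "'a::comm_ring_1 set"
  assumes "is_ideal M"
  shows "scale_coset M r (a +o M) = (r * a) +o M"
proof -
  have s: "module.subspace (*) M" using assms by (simp add: is_ideal_def)
  have "x \<in> (r * a) +o M" if x: "x \<in> scale_coset M r (a +o M)" for x
  proof -
    obtain m m' where "m \<in> M" "m' \<in> M" "x = r * (a + m) + m'"
      using x unfolding scale_coset_def elt_set_plus_def by blast
    moreover from this have "r * m + m' \<in> M"
      using module.subspace_add[OF module_self s] module.subspace_scale[OF module_self s] by blast
    ultimately show ?thesis
      by (auto simp: elt_set_plus_def algebra_simps)
  qed
  moreover have "a \<in> a +o M"
    using module.subspace_0[OF module_self s] by (force simp: elt_set_plus_def)
  ultimately show ?thesis by (auto simp: scale_coset_def)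
qed

definition socle :: "'a::comm_ring_1 set \<Rightarrow> 'a set" where
  "socle M = {r. \<forall>a\<in>M. a * r = 0}"

text \<open>For the maximal ideal \<open>M\<close> of a local Artinian ring: the socle is isomorphic, as a module
  over the ring, to the residue field.\<close>

definition is_frobenius :: "'a::comm_ring_1 set \<Rightarrow> bool" where
  "is_frobenius M \<longleftrightarrow>
     (\<exists>\<phi>. bij_betw \<phi> (socle M) (quotient_by M) \<and>
          (\<forall>x\<in>socle M. \<forall>y\<in>socle M. \<phi> (x + y) = \<phi> x + \<phi> y) \<and>
          (\<forall>r. \<forall>x\<in>socle M. \<phi> (r * x) = scale_coset M r (\<phi> x)))"

text \<open>A code of length \<open>CARD('n)\<close>, which is positive since types are nonempty.\<close>

definition is_code :: "('a::comm_ring_1 ^ 'n) set \<Rightarrow> bool" where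
  "is_code C \<longleftrightarrow> module.subspace (*s) C"

definition is_free_code :: "('a::comm_ring_1 ^ 'n) set \<Rightarrow> bool" where
  "is_free_code C \<longleftrightarrow> is_code C \<and>
     (\<exists>B\<subseteq>C. \<not> module.dependent (*s) B \<and> module.span (*s) B = C)"

definition orthogonal_code :: "('a::comm_ring_1 ^ 'n) set \<Rightarrow> ('a ^ 'n) set" where
  "orthogonal_code C = {v. \<forall>w\<in>C. scalar_product v w = 0}"

definition code_hull :: "('a::comm_ring_1 ^ 'n) set \<Rightarrow> ('a ^ 'n) set" where
  "code_hull C = C \<inter> orthogonal_code C"

definition is_lcd :: "('a::comm_ring_1 ^ 'n) set \<Rightarrow> bool" where
  "is_lcd C \<longleftrightarrow> code_hull C = {0}"

end

theory Submission
  imports Defs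
begin

text \<open>
  The LCD condition says that the standard form restricted to \<open>C\<close> has zero radical. Over a field this
  already gives an orthogonal decomposition of \<open>C\<close> into blocks of dimension one and two; the proof
  carries this over to a local Artinian ring, where it produces a basis of \<open>C\<close>.

  What has to be excluded is that the form on a nonzero LCD code takes all its values in \<open>\<mm>\<close>. The
  descending chain condition gives \<open>r\<close> with \<open>r C \<noteq> 0\<close> and \<open>r \<mm> C = 0\<close>, and for a form with values in
  \<open>\<mm>\<close> the code \<open>r C\<close> would lie in the hull (\<open>lcd_code_unit_value\<close>). Hence some value \<open>v \<cdot> w\<close> is a
  unit, and one of \<open>{v}\<close>, \<open>{w}\<close>, \<open>{v, w}\<close> has an invertible Gram matrix
  (\<open>unimodular_block_from_unit_value\<close>). Such a block \<open>F\<close> is a basis of its span, and \<open>C\<close> is the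
  direct sum of this span and \<open>C \<inter> F\<^sup>\<bottom>\<close>, which is again LCD (\<open>lcd_orthogonal_complement\<close>) and strictly
  smaller. Codes of a fixed length satisfy the descending chain condition (\<open>wf_proper_subcode\<close>), so
  this splitting is a well-founded induction, and the blocks together form a basis of \<open>C\<close>.
\<close>

interpretation ring_mod: module "(*) :: 'a::comm_ring_1 \<Rightarrow> 'a \<Rightarrow> 'a"
  by (rule module_self)

text \<open>As a rewrite rule, the associativity of scaling undoes \<open>mult.assoc\<close> when the ring acts on
  itself.\<close>

declare ring_mod.scale_scale [simp del]

interpretation vec_mod: module "(*s) :: 'a::comm_ring_1 \<Rightarrow> 'a ^ 'n \<Rightarrow> 'a ^ 'n"
  by (rule module_vec)

section \<open>The standard bilinear form\<close>

lemma scalar_product_simps: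
  fixes v w :: "'a::comm_ring_1 ^ 'n"
  shows "scalar_product (v + v') w = scalar_product v w + scalar_product v' w"
    and "scalar_product w (v + v') = scalar_product w v + scalar_product w v'"
    and "scalar_product (v - v') w = scalar_product v w - scalar_product v' w"
    and "scalar_product (r *s v) w = r * scalar_product v w"
    and "scalar_product v (r *s w) = r * scalar_product v w"
    and "scalar_product 0 w = 0"
    and "scalar_product w 0 = 0"
  by (simp_all add: scalar_product_def sum.distrib sum_subtractf sum_distrib_left algebra_simps)

lemma scalar_product_commute:
  fixes v w :: "'a::comm_ring_1 ^ 'n"
  shows "scalar_product v w = scalar_product w v"
  by (simp add: scalar_product_def mult.commute)

lemma subspace_orthogonal_code: "vec_mod.subspace (orthogonal_code F)"
  by (rule vec_mod.subspaceI) (auto simp: orthogonal_code_def scalar_product_simps)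

lemma orthogonal_code_span:
  "orthogonal_code (vec_mod.span F) = orthogonal_code F"
proof -
  have "scalar_product v w = 0" if "v \<in> orthogonal_code F" "w \<in> vec_mod.span F" for v w
    using that(2)
    by (induction rule: vec_mod.span_induct_alt)
      (use that(1) in \<open>auto simp: orthogonal_code_def scalar_product_simps\<close>)
  then show ?thesis
    by (auto simp: orthogonal_code_def vec_mod.span_base)
qed

section \<open>Local Artinian rings\<close>

lemma is_ideal_principal: "is_ideal (range ((*) (r::'a::comm_ring_1)))"
proof -
  have "range ((*) r) = ring_mod.span {r}"
    by (auto simp: ring_mod.span_singleton mult.commute)
  then show ?thesis
    by (simp add: is_ideal_def)
qed

text \<open>If \<open>x\<close> is not a unit, the ideal \<open>x R\<close> is proper, and by Zorn's lemma it lies in a maximal ideal,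
  which can only be \<open>\<mm>\<close>: properness of an ideal \<open>J\<close> is the condition \<open>1 \<notin> J\<close>, which passes to unions
  of chains.\<close>

lemma unit_outside_maximal_ideal:
  fixes x :: "'a::comm_ring_1"
  assumes loc: "is_local_ring \<mm>" and x: "x \<notin> \<mm>"
  obtains y where "x * y = 1"
proof (cases "1 \<in> range ((*) x)")
  case True
  then show ?thesis using that by auto
next
  case False
  have proper: "J \<noteq> UNIV \<longleftrightarrow> 1 \<notin> J" if "is_ideal J" for J :: "'a set"
  proof -
    have "a \<in> J" if "1 \<in> J" for a
      using ring_mod.subspace_scale[of J 1 a] \<open>is_ideal J\<close> that by (simp add: is_ideal_def)
    then show ?thesis by auto
  qed
  define \<A> where "\<A> = {J. is_ideal J \<and> range ((*) x) \<subseteq> J \<and> 1 \<notin> J}"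
  have "range ((*) x) \<in> \<A>"
    using False by (simp add: \<A>_def is_ideal_principal)
  moreover have "\<Union>\<C> \<in> \<A>" if "\<C> \<noteq> {}" and ch: "subset.chain \<A> \<C>" for \<C>
  proof -
    have sub: "J \<in> \<A>" if "J \<in> \<C>" for J
      using ch that by (auto simp: subset_chain_def)
    have id: "ring_mod.subspace J" if "J \<in> \<C>" for J
      using sub[OF that] by (simp add: \<A>_def is_ideal_def)
    have "ring_mod.subspace (\<Union>\<C>)"
    proof (rule ring_mod.subspaceI)
      show "0 \<in> \<Union>\<C>"
        using \<open>\<C> \<noteq> {}\<close> id ring_mod.subspace_0 by blast
    next
      fix a b assume "a \<in> \<Union>\<C>" "b \<in> \<Union>\<C>"
      then obtain J K where JK: "J \<in> \<C>" "a \<in> J" "K \<in> \<C>" "b \<in> K" by blast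
      then have "J \<subseteq> K \<or> K \<subseteq> J"
        using ch by (auto simp: subset_chain_def)
      then show "a + b \<in> \<Union>\<C>"
        using JK id ring_mod.subspace_add by (meson UnionI subsetD)
    next
      fix c a assume "a \<in> \<Union>\<C>"
      then show "c * a \<in> \<Union>\<C>"
        using id ring_mod.subspace_scale by blast
    qed
    then show ?thesis
      using \<open>\<C> \<noteq> {}\<close> sub by (auto simp: \<A>_def is_ideal_def)
  qed
  ultimately obtain M where M: "M \<in> \<A>" and max: "\<And>J. J \<in> \<A> \<Longrightarrow> M \<subseteq> J \<Longrightarrow> J = M"
    using subset_Zorn_nonempty[of \<A>] by blast
  have "is_maximal_ideal M"
    unfolding is_maximal_ideal_def
  proof (intro conjI allI impI)
    show "is_ideal M" "M \<noteq> UNIV"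
      using M by (auto simp: \<A>_def)
    fix J assume "is_ideal J \<and> M \<subseteq> J \<and> J \<noteq> UNIV"
    then show "J = M"
      using M max[of J] proper[of J] by (auto simp: \<A>_def)
  qed
  then have "M = \<mm>"
    using loc by (simp add: is_local_ring_def)
  moreover have "x * 1 \<in> M"
    using M unfolding \<A>_def by blast
  ultimately show ?thesis
    using x by simp
qed

lemma one_minus_maximal_unit:
  fixes a :: "'a::comm_ring_1"
  assumes loc: "is_local_ring \<mm>" and a: "a \<in> \<mm>"
  obtains y where "(1 - a) * y = 1"
proof -
  have m: "ring_mod.subspace \<mm>" "\<mm> \<noteq> UNIV"
    using loc by (auto simp: is_local_ring_def is_maximal_ideal_def is_ideal_def)
  have "1 - a \<notin> \<mm>"
  proof
    assume "1 - a \<in> \<mm>"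
    then have "1 \<in> \<mm>"
      using ring_mod.subspace_add[OF m(1) _ a, of "1 - a"] by simp
    then have "b \<in> \<mm>" for b
      using ring_mod.subspace_scale[OF m(1), of 1 b] by simp
    then show False using m(2) by auto
  qed
  then show ?thesis
    using unit_outside_maximal_ideal[OF loc] that by blast
qed

text \<open>This produces a nonzero part \<open>r C\<close> of \<open>C\<close> that \<open>\<mm>\<close> annihilates. If every \<open>r\<close> with
  \<open>r C \<noteq> 0\<close> could be multiplied by an element of \<open>\<mm>\<close> without killing \<open>C\<close>, the resulting descending
  chain of principal ideals would become stationary, \<open>r = r a t\<close> with \<open>a \<in> \<mm>\<close>, and then
  \<open>r = 0\<close> because \<open>1 - a t\<close> is a unit.\<close>

lemma nonzero_multiple_killed_by_maximal_ideal:
  fixes \<mm> :: "'a::comm_ring_1 set" and C :: "('a ^ 'n) set"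
  assumes loc: "is_local_ring \<mm>" and art: "is_artinian TYPE('a)"
    and v: "v \<in> C" "v \<noteq> 0"
  obtains r w where "w \<in> C" "r *s w \<noteq> 0" "\<And>a u. a \<in> \<mm> \<Longrightarrow> u \<in> C \<Longrightarrow> (r * a) *s u = 0"
proof (rule ccontr)
  assume none: "\<not> thesis"
  note witness = that
  define good where "good r \<longleftrightarrow> (\<exists>w\<in>C. r *s w \<noteq> 0)" for r
  have step: "\<exists>a\<in>\<mm>. good (r * a)" if "good r" for r
    using none witness that unfolding good_def by blast
  have "\<exists>f. \<forall>k. good (f k) \<and> (\<exists>a\<in>\<mm>. f (Suc k) = f k * a)"
  proof (rule dependent_nat_choice)
    have "good 1" using v by (auto simp: good_def)
    then show "\<exists>r. good r" ..
    show "\<exists>s. good s \<and> (\<exists>a\<in>\<mm>. s = r * a)" if "good r" for r and k :: nat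
      using step[OF that] by blast
  qed
  then obtain f where good: "\<And>k. good (f k)" and f: "\<And>k. \<exists>a\<in>\<mm>. f (Suc k) = f k * a"
    by blast
  have "decseq (\<lambda>k. range ((*) (f k)))"
  proof (rule decseq_SucI)
    fix k
    obtain a where "f (Suc k) = f k * a" using f by blast
    then show "range ((*) (f (Suc k))) \<subseteq> range ((*) (f k))"
      by (auto simp: mult.assoc)
  qed
  then obtain N where N: "\<And>k. k \<ge> N \<Longrightarrow> range ((*) (f k)) = range ((*) (f N))"
    using art is_ideal_principal unfolding is_artinian_def by meson
  obtain a where a: "a \<in> \<mm>" "f (Suc N) = f N * a" using f by blast
  have stat: "range ((*) (f (Suc N))) = range ((*) (f N))"
    by (rule N) simp
  have "f N * 1 \<in> range ((*) (f (Suc N)))"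
    unfolding stat by (rule rangeI)
  then obtain t where t: "f N = f N * a * t" using a(2) by auto
  have "t * a \<in> \<mm>"
    using loc a(1) ring_mod.subspace_scale
    by (auto simp: is_local_ring_def is_maximal_ideal_def is_ideal_def)
  then obtain y where y: "(1 - t * a) * y = 1"
    using one_minus_maximal_unit[OF loc] by blast
  have "f N = f N * ((1 - t * a) * y)" using y by simp
  also have "\<dots> = (f N - f N * a * t) * y" by (simp add: algebra_simps)
  finally have "f N = 0" using t by simp
  then show False using good[of N] by (simp add: good_def)
qed

section \<open>Descending chains of codes\<close>

text \<open>The descending chain condition passes from the ring to its powers one coordinate at a time:
  once the ideal of possible \<open>i\<close>-th coordinates and the subcode with \<open>i\<close>-th coordinate zero are
  both stationary, so is the code.\<close>

lemma codes_supported_on_stationary: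
  fixes C :: "nat \<Rightarrow> ('a::comm_ring_1 ^ 'n) set" and S :: "'n set"
  assumes art: "is_artinian TYPE('a)" and sub: "\<And>k. vec_mod.subspace (C k)"
    and dec: "decseq C"
  shows "\<exists>N. \<forall>k\<ge>N. \<forall>v\<in>C N. (\<forall>i. i \<notin> S \<longrightarrow> v $ i = 0) \<longrightarrow> v \<in> C k"
  using finite[of S]
proof (induction S rule: finite_induct)
  case empty
  have "v \<in> C k" if "\<forall>i. v $ i = 0" for v k
  proof -
    have "v = 0" using that by (simp add: vec_eq_iff)
    then show ?thesis using vec_mod.subspace_0[OF sub] by simp
  qed
  then show ?case by auto
next
  case (insert i S)
  define V where "V k = {v \<in> C k. \<forall>j. j \<notin> insert i S \<longrightarrow> v $ j = 0}" for k
  define I where "I k = (\<lambda>v. v $ i) ` V k" for k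
  have subV: "vec_mod.subspace (V k)" for k
    using sub[of k] by (auto simp: vec_mod.subspace_def V_def)
  have "is_ideal (I k)" for k
    unfolding is_ideal_def
  proof (rule ring_mod.subspaceI)
    show "0 \<in> I k"
      using vec_mod.subspace_0[OF subV[of k]] by (force simp: I_def)
  next
    fix x y assume "x \<in> I k" "y \<in> I k"
    then obtain v w where "v \<in> V k" "w \<in> V k" "x = v $ i" "y = w $ i"
      by (auto simp: I_def)
    then show "x + y \<in> I k"
      using vec_mod.subspace_add[OF subV] unfolding I_def
      by (intro image_eqI[where x = "v + w"]) auto
  next
    fix c x assume "x \<in> I k"
    then obtain v where "v \<in> V k" "x = v $ i"
      by (auto simp: I_def)
    then show "c * x \<in> I k"
      using vec_mod.subspace_scale[OF subV] unfolding I_def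
      by (intro image_eqI[where x = "c *s v"]) auto
  qed
  moreover have decV: "V k' \<subseteq> V k" if "k \<le> k'" for k k'
    using decseqD[OF dec that] by (auto simp: V_def)
  then have "decseq I"
    by (auto simp: decseq_def I_def)
  ultimately obtain N where N: "\<And>k. k \<ge> N \<Longrightarrow> I k = I N"
    using art unfolding is_artinian_def by meson
  obtain L where L: "\<And>k v. k \<ge> L \<Longrightarrow> v \<in> C L \<Longrightarrow> (\<forall>j. j \<notin> S \<longrightarrow> v $ j = 0) \<Longrightarrow> v \<in> C k"
    using insert.IH by blast
  show ?case
  proof (intro exI[of _ "max N L"] allI impI ballI)
    fix k v assume k: "k \<ge> max N L" and v: "v \<in> C (max N L)"
      and supp: "\<forall>j. j \<notin> insert i S \<longrightarrow> v $ j = 0"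
    have vV: "v \<in> V (max N L)" using v supp by (simp add: V_def)
    then have "v $ i \<in> I k"
      using N[of k] N[of "max N L"] k by (auto simp: I_def)
    then obtain w where w: "w \<in> V k" "v $ i = w $ i" by (auto simp: I_def)
    then have "w \<in> V (max N L)" using decV[OF k] by blast
    then have "v - w \<in> V (max N L)"
      using vV vec_mod.subspace_diff[OF subV] by blast
    then have d: "v - w \<in> V L" using decV[of L "max N L"] by auto
    have "v - w \<in> C k"
    proof (rule L)
      show "v - w \<in> C L" using d by (simp add: V_def)
      show "\<forall>j. j \<notin> S \<longrightarrow> (v - w) $ j = 0"
        using d w(2) by (auto simp: V_def)
    qed (use k in simp)
    then have "(v - w) + w \<in> C k"
      using w(1) vec_mod.subspace_add[OF sub] unfolding V_def by blast
    then show "v \<in> C k" by simp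
  qed
qed

lemma wf_proper_subcode:
  assumes art: "is_artinian TYPE('a::comm_ring_1)"
  shows "wf {(D, C :: ('a ^ 'n) set). is_code D \<and> is_code C \<and> D \<subset> C}"
  unfolding wf_iff_no_infinite_down_chain
proof
  assume "\<exists>f. \<forall>k. (f (Suc k), f k) \<in> {(D, C :: ('a ^ 'n) set). is_code D \<and> is_code C \<and> D \<subset> C}"
  then obtain f :: "nat \<Rightarrow> ('a ^ 'n) set"
    where "\<forall>k. is_code (f (Suc k)) \<and> is_code (f k) \<and> f (Suc k) \<subset> f k" by auto
  then have f: "\<And>k. is_code (f k)" "\<And>k. f (Suc k) \<subset> f k" by blast+
  have "decseq f" using f(2) by (intro decseq_SucI) auto
  then obtain N where "\<forall>k\<ge>N. \<forall>v\<in>f N. (\<forall>i. i \<notin> UNIV \<longrightarrow> v $ i = 0) \<longrightarrow> v \<in> f k"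
    using codes_supported_on_stationary[OF art, of f UNIV] f(1) by (auto simp: is_code_def)
  then have "f N \<subseteq> f (Suc N)" by auto
  then show False using f(2)[of N] by blast
qed

section \<open>A unit value of the form on a nonzero LCD code\<close>

text \<open>Suppose that the form maps \<open>C\<close> into \<open>\<mm>\<close>, and choose \<open>r\<close> with \<open>r C \<noteq> 0\<close> and \<open>r \<mm> C = 0\<close>.
  If some \<open>v \<in> C\<close> has a unit coordinate, then \<open>r \<mm> = 0\<close>, so \<open>r\<close> kills all values of the form.
  Otherwise \<open>C \<subseteq> \<mm> R\<^sup>n\<close>, and \<open>r\<close> kills each product of coordinates of two codewords. In both cases
  \<open>r C\<close> is a nonzero part of the hull.\<close>

lemma lcd_code_unit_value:
  fixes \<mm> :: "'a::comm_ring_1 set" and C :: "('a ^ 'n) set"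
  assumes loc: "is_local_ring \<mm>" and art: "is_artinian TYPE('a)"
    and code: "is_code C" and lcd: "is_lcd C" and "C \<noteq> {0}"
  obtains v w where "v \<in> C" "w \<in> C" "scalar_product v w \<notin> \<mm>"
proof (rule ccontr)
  assume none: "\<not> thesis"
  note witness = that
  have val: "scalar_product v w \<in> \<mm>" if "v \<in> C" "w \<in> C" for v w
    using none witness that by blast
  have C: "vec_mod.subspace C" using code by (simp add: is_code_def)
  then obtain v where "v \<in> C" "v \<noteq> 0"
    using \<open>C \<noteq> {0}\<close> vec_mod.subspace_0 by blast
  then obtain r w where w: "w \<in> C" "r *s w \<noteq> 0"
    and r: "\<And>a u. a \<in> \<mm> \<Longrightarrow> u \<in> C \<Longrightarrow> (r * a) *s u = 0"
    using nonzero_multiple_killed_by_maximal_ideal[OF loc art] by metis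
  have r_coord: "r * a * u $ i = 0" if "a \<in> \<mm>" "u \<in> C" for a u i
    using r[OF that] by (metis vector_smult_component zero_index)
  have kill: "r * scalar_product w u = 0" if u: "u \<in> C" for u
  proof (cases "\<exists>x\<in>C. \<exists>i. x $ i \<notin> \<mm>")
    case True
    then obtain x i y where "x \<in> C" and y: "x $ i * y = 1"
      using unit_outside_maximal_ideal[OF loc] by metis
    then have "r * scalar_product w u * x $ i = 0"
      using r_coord val w(1) u by blast
    then have "r * scalar_product w u * (x $ i * y) = 0"
      by (simp add: mult.assoc[symmetric])
    then show ?thesis using y by simp
  next
    case False
    then have "r * w $ i * u $ i = 0" for i
      using r_coord w(1) u by blast
    then show ?thesis
      by (simp add: scalar_product_def sum_distrib_left mult.assoc)
  qed
  then have "r *s w \<in> code_hull C"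
    using w(1) vec_mod.subspace_scale[OF C]
    by (auto simp: code_hull_def orthogonal_code_def scalar_product_simps)
  then show False using lcd w(2) by (simp add: is_lcd_def)
qed

section \<open>Splitting off unimodular blocks\<close>

text \<open>For finite \<open>F\<close> this is invertibility of the Gram matrix, phrased without matrices: \<open>F\<close> is
  independent and every vector has a unique orthogonal projection to the span of \<open>F\<close>.\<close>

definition unimodular_block :: "('a::comm_ring_1 ^ 'n) set \<Rightarrow> bool" where
  "unimodular_block F \<longleftrightarrow> vec_mod.independent F \<and>
     vec_mod.span F \<inter> orthogonal_code F = {0} \<and>
     (\<forall>x. \<exists>f\<in>vec_mod.span F. x - f \<in> orthogonal_code F)"

lemma unimodular_block_singleton:
  fixes v :: "'a::comm_ring_1 ^ 'n"
  assumes u: "scalar_product v v * u = 1"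
  shows "unimodular_block {v}"
proof -
  have z: "t = 0" if "t * scalar_product v v = 0" for t
  proof -
    have "t = t * scalar_product v v * u" using u by (simp add: mult.assoc)
    then show ?thesis using that by simp
  qed
  have "vec_mod.independent {v}"
    unfolding vec_mod.independent_explicit_module
  proof (intro allI impI)
    fix t c x assume t: "t \<subseteq> {v}" "(\<Sum>y\<in>t. c y *s y) = 0" "x \<in> t"
    then have "c x *s x = 0" "x = v" by (auto simp: subset_singleton_iff)
    then have "scalar_product (c x *s x) v = 0" by (simp add: scalar_product_simps)
    then show "c x = 0" using \<open>x = v\<close> z by (simp add: scalar_product_simps)
  qed
  moreover have "vec_mod.span {v} \<inter> orthogonal_code {v} = {0}"
  proof
    show "vec_mod.span {v} \<inter> orthogonal_code {v} \<subseteq> {0}"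
    proof
      fix x assume "x \<in> vec_mod.span {v} \<inter> orthogonal_code {v}"
      then obtain t where "x = t *s v" "t * scalar_product v v = 0"
        by (auto simp: vec_mod.span_singleton orthogonal_code_def scalar_product_simps)
      then show "x \<in> {0}" using z[of t] by simp
    qed
    show "{0} \<subseteq> vec_mod.span {v} \<inter> orthogonal_code {v}"
      using vec_mod.span_zero vec_mod.subspace_0[OF subspace_orthogonal_code] by blast
  qed
  moreover have "\<exists>f\<in>vec_mod.span {v}. x - f \<in> orthogonal_code {v}" for x
  proof
    show "(scalar_product x v * u) *s v \<in> vec_mod.span {v}"
      by (simp add: vec_mod.span_scale vec_mod.span_base)
    have "scalar_product x v * u * scalar_product v v = scalar_product x v"
      using u by (simp add: mult.assoc mult.commute[of u])
    then show "x - (scalar_product x v * u) *s v \<in> orthogonal_code {v}"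
      by (simp add: orthogonal_code_def scalar_product_simps)
  qed
  ultimately show ?thesis by (simp add: unimodular_block_def)
qed

text \<open>All conditions amount to solving linear systems with the Gram matrix of \<open>v, w\<close>, which is
  invertible when its determinant is.\<close>

lemma unimodular_block_pair:
  fixes v w :: "'a::comm_ring_1 ^ 'n"
  defines "a \<equiv> scalar_product v v" and "b \<equiv> scalar_product v w" and "c \<equiv> scalar_product w w"
  assumes e: "(a * c - b * b) * e = 1" and "v \<noteq> w"
  shows "unimodular_block {v, w}"
proof -
  have gram: "scalar_product v v = a" "scalar_product v w = b" "scalar_product w v = b"
    "scalar_product w w = c"
    by (simp_all add: a_def b_def c_def scalar_product_commute)
  have span: "x \<in> vec_mod.span {v, w} \<longleftrightarrow> (\<exists>s t. x = s *s v + t *s w)" for x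
    unfolding insert_is_Un[of v "{w}"] vec_mod.span_Un vec_mod.span_singleton by blast
  have z: "s = 0 \<and> t = 0" if st: "s * a + t * b = 0" "s * b + t * c = 0" for s t
  proof
    have "s = s * ((a * c - b * b) * e)" using e by simp
    also have "\<dots> = (c * (s * a + t * b) - b * (s * b + t * c)) * e"
      by (simp add: algebra_simps)
    finally show "s = 0" using st by simp
    have "t = t * ((a * c - b * b) * e)" using e by simp
    also have "\<dots> = (a * (s * b + t * c) - b * (s * a + t * b)) * e"
      by (simp add: algebra_simps)
    finally show "t = 0" using st by simp
  qed
  have perp: "s = 0 \<and> t = 0" if "s *s v + t *s w \<in> orthogonal_code {v, w}" for s t
    using that z[of s t] by (simp add: orthogonal_code_def scalar_product_simps gram)
  have zero: "0 \<in> orthogonal_code {v, w}"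
    by (rule vec_mod.subspace_0[OF subspace_orthogonal_code])
  have "vec_mod.independent {v, w}"
    unfolding vec_mod.independent_explicit_module
  proof (intro allI impI)
    fix T k x assume T: "finite T" "T \<subseteq> {v, w}" "(\<Sum>y\<in>T. k y *s y) = 0" "x \<in> T"
    \<comment> \<open>Extending the coefficients by zero leaves only the case of the full set \<open>{v, w}\<close>.\<close>
    define k' where "k' y = (if y \<in> T then k y else 0)" for y
    have "(\<Sum>y\<in>{v, w}. k' y *s y) = (\<Sum>y\<in>T. k y *s y)"
      using T(2) by (intro sum.mono_neutral_cong_right) (auto simp: k'_def)
    then have "k' v *s v + k' w *s w = 0" using \<open>v \<noteq> w\<close> T(3) by simp
    then have "k' v = 0 \<and> k' w = 0" using perp[of "k' v" "k' w"] zero by simp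
    then show "k x = 0" using T(2,4) by (auto simp: k'_def split: if_splits)
  qed
  moreover have "vec_mod.span {v, w} \<inter> orthogonal_code {v, w} = {0}"
  proof
    show "vec_mod.span {v, w} \<inter> orthogonal_code {v, w} \<subseteq> {0}"
    proof
      fix x assume "x \<in> vec_mod.span {v, w} \<inter> orthogonal_code {v, w}"
      then obtain s t where "x = s *s v + t *s w" "x \<in> orthogonal_code {v, w}"
        using span by blast
      then show "x \<in> {0}" using perp[of s t] by simp
    qed
    show "{0} \<subseteq> vec_mod.span {v, w} \<inter> orthogonal_code {v, w}"
      using vec_mod.span_zero zero by blast
  qed
  moreover have "\<exists>f\<in>vec_mod.span {v, w}. x - f \<in> orthogonal_code {v, w}" for x
  proof -
    define p q where "p = scalar_product x v" and "q = scalar_product x w"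
    \<comment> \<open>The coefficients of the projection are given by Cramer's rule.\<close>
    define s t where "s = (p * c - q * b) * e" and "t = (q * a - p * b) * e"
    have "s * a + t * b = p * ((a * c - b * b) * e)" "s * b + t * c = q * ((a * c - b * b) * e)"
      by (simp_all add: s_def t_def algebra_simps)
    then have "s * a + t * b = p" "s * b + t * c = q" using e by simp_all
    then have "x - (s *s v + t *s w) \<in> orthogonal_code {v, w}"
      by (simp add: orthogonal_code_def scalar_product_simps gram p_def q_def)
    then show ?thesis using span by blast
  qed
  ultimately show ?thesis by (simp add: unimodular_block_def)
qed

text \<open>A unit value \<open>v \<cdot> w\<close> yields a block: \<open>{v}\<close> or \<open>{w}\<close> if one of them has unit square, and otherwise
  \<open>{v, w}\<close>, whose Gram determinant is \<open>- (v \<cdot> w)\<^sup>2\<close> modulo \<open>\<mm>\<close>. The two-dimensional block is unavoidable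
  in residue characteristic 2, where a form with a unit value may have all squares in \<open>\<mm>\<close>.\<close>

lemma unimodular_block_from_unit_value:
  fixes \<mm> :: "'a::comm_ring_1 set" and v w :: "'a ^ 'n"
  assumes loc: "is_local_ring \<mm>" and vw: "scalar_product v w \<notin> \<mm>"
  obtains F where "F \<subseteq> {v, w}" "F \<noteq> {}" "unimodular_block F"
proof (cases "scalar_product v v \<in> \<mm> \<and> scalar_product w w \<in> \<mm>")
  case False
  then obtain x u where "x \<in> {v, w}" "scalar_product x x * u = 1"
    using unit_outside_maximal_ideal[OF loc] by (metis insertCI)
  then show ?thesis
    using unimodular_block_singleton that[of "{x}"] by blast
next
  case True
  define a b c where "a = scalar_product v v" and "b = scalar_product v w" and "c = scalar_product w w"
  have m: "ring_mod.subspace \<mm>"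
    using loc by (auto simp: is_local_ring_def is_maximal_ideal_def is_ideal_def)
  obtain u where u: "b * u = 1"
    using unit_outside_maximal_ideal[OF loc vw] by (auto simp: b_def)
  have "a * c - b * b \<notin> \<mm>"
  proof
    assume "a * c - b * b \<in> \<mm>"
    moreover have "a * c \<in> \<mm>"
      using True ring_mod.subspace_scale[OF m] by (simp add: c_def)
    ultimately have "a * c - (a * c - b * b) \<in> \<mm>"
      using ring_mod.subspace_diff[OF m] by blast
    then have "u * (b * b) \<in> \<mm>"
      using ring_mod.subspace_scale[OF m, of "b * b" u] by simp
    moreover have "u * (b * b) = b"
      using u by (metis mult.assoc mult.commute mult_1)
    ultimately show False using vw by (simp add: b_def)
  qed
  then obtain e where "(a * c - b * b) * e = 1"
    using unit_outside_maximal_ideal[OF loc] by blast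
  moreover have "v \<noteq> w" using True vw by auto
  ultimately have "unimodular_block {v, w}"
    using unimodular_block_pair[of v w e] by (simp add: a_def b_def c_def)
  then show ?thesis using that by blast
qed

text \<open>A relation on the union splits into a vector of each
  span, and these are opposite, hence zero.\<close>

lemma independent_Un_direct:
  fixes A B :: "('a::comm_ring_1 ^ 'n) set"
  assumes A: "vec_mod.independent A" and B: "vec_mod.independent B"
    and dir: "vec_mod.span A \<inter> vec_mod.span B = {0}"
  shows "vec_mod.independent (A \<union> B)"
  unfolding vec_mod.independent_explicit_module
proof (intro allI impI)
  fix t k x assume t: "finite t" "t \<subseteq> A \<union> B" "(\<Sum>y\<in>t. k y *s y) = 0" "x \<in> t"
  have disj: "A \<inter> B = {}"
  proof -
    have "A \<inter> B \<subseteq> {0}"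
      using dir vec_mod.span_superset by blast
    then show ?thesis
      using A vec_mod.dependent_zero by blast
  qed
  define p q where "p = (\<Sum>y\<in>t \<inter> A. k y *s y)" and "q = (\<Sum>y\<in>t \<inter> B. k y *s y)"
  have "(t \<inter> A) \<union> (t \<inter> B) = t" "(t \<inter> A) \<inter> (t \<inter> B) = {}"
    using t(2) disj by blast+
  then have "p + q = (\<Sum>y\<in>t. k y *s y)"
    using sum.union_disjoint[of "t \<inter> A" "t \<inter> B" "\<lambda>y. k y *s y"] t(1)
    by (simp add: p_def q_def)
  then have pq: "p = - q" using t(3) by (simp add: eq_neg_iff_add_eq_0)
  have pA: "p \<in> vec_mod.span A"
    unfolding p_def by (intro vec_mod.span_sum vec_mod.span_scale vec_mod.span_base) blast
  have "q \<in> vec_mod.span B"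
    unfolding q_def by (intro vec_mod.span_sum vec_mod.span_scale vec_mod.span_base) blast
  then have "p \<in> vec_mod.span B"
    unfolding pq by (rule vec_mod.span_neg)
  then have p: "p = 0" using dir pA by blast
  then have q: "q = 0" using pq by simp
  consider "x \<in> t \<inter> A" | "x \<in> t \<inter> B" using t(2,4) by blast
  then show "k x = 0"
  proof cases
    case 1
    then show ?thesis
      using vec_mod.independentD[OF A, of "t \<inter> A" k x] t(1) p unfolding p_def by blast
  next
    case 2
    then show ?thesis
      using vec_mod.independentD[OF B, of "t \<inter> B" k x] t(1) q unfolding q_def by blast
  qed
qed

text \<open>The complement \<open>C \<inter> F\<^sup>\<bottom>\<close> inherits the LCD property because \<open>C\<close> is spanned by it and \<open>F\<close>: a vector
  of the complement that is orthogonal to the complement is orthogonal to all of \<open>C\<close>.\<close>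

lemma lcd_orthogonal_complement:
  assumes code: "is_code C" and lcd: "is_lcd C" and F: "F \<subseteq> C" "unimodular_block F"
  shows "is_lcd (C \<inter> orthogonal_code F)"
proof -
  have C: "vec_mod.subspace C" using code by (simp add: is_code_def)
  have "code_hull (C \<inter> orthogonal_code F) \<subseteq> code_hull C"
  proof
    fix x assume "x \<in> code_hull (C \<inter> orthogonal_code F)"
    then have x: "x \<in> C" "x \<in> orthogonal_code F" "x \<in> orthogonal_code (C \<inter> orthogonal_code F)"
      by (auto simp: code_hull_def)
    have "scalar_product x w = 0" if w: "w \<in> C" for w
    proof -
      obtain f where f: "f \<in> vec_mod.span F" "w - f \<in> orthogonal_code F"
        using F(2) by (auto simp: unimodular_block_def)
      have "f \<in> C" using f(1) vec_mod.span_minimal[OF F(1) C] by blast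
      then have "w - f \<in> C" using w C vec_mod.subspace_diff by blast
      then have "scalar_product x (w - f) = 0"
        using f(2) x(3) by (auto simp: orthogonal_code_def)
      moreover have "scalar_product x f = 0"
        using x(2) f(1) orthogonal_code_span[of F] by (auto simp: orthogonal_code_def)
      ultimately show ?thesis
        using scalar_product_simps(2)[of x "w - f" f] by simp
    qed
    then show "x \<in> code_hull C" using x(1) by (simp add: code_hull_def orthogonal_code_def)
  qed
  moreover have "0 \<in> code_hull (C \<inter> orthogonal_code F)"
    using vec_mod.subspace_0[OF C] vec_mod.subspace_0[OF subspace_orthogonal_code]
    by (auto simp: code_hull_def)
  ultimately show ?thesis using lcd by (auto simp: is_lcd_def)
qed

lemma free_of_free_orthogonal_complement:
  assumes code: "is_code C" and F: "F \<subseteq> C" "unimodular_block F"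
    and free: "is_free_code (C \<inter> orthogonal_code F)"
  shows "is_free_code C"
proof -
  have C: "vec_mod.subspace C" using code by (simp add: is_code_def)
  obtain B where B: "vec_mod.independent B" "vec_mod.span B = C \<inter> orthogonal_code F"
    using free by (auto simp: is_free_code_def)
  have block: "vec_mod.independent F" "vec_mod.span F \<inter> orthogonal_code F = {0}"
    using F(2) by (auto simp: unimodular_block_def)
  have FC: "vec_mod.span F \<subseteq> C"
    by (rule vec_mod.span_minimal[OF F(1) C])
  have "vec_mod.span F \<inter> vec_mod.span B = {0}"
    using B(2) FC block(2) by auto
  then have "vec_mod.independent (F \<union> B)"
    by (rule independent_Un_direct[OF block(1) B(1)])
  moreover have BC: "F \<union> B \<subseteq> C"
    using F(1) B(2) vec_mod.span_superset[of B] by auto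
  moreover have "vec_mod.span (F \<union> B) = C"
  proof
    show "vec_mod.span (F \<union> B) \<subseteq> C"
      by (rule vec_mod.span_minimal[OF BC C])
    show "C \<subseteq> vec_mod.span (F \<union> B)"
    proof
      fix x assume x: "x \<in> C"
      obtain f where f: "f \<in> vec_mod.span F" "x - f \<in> orthogonal_code F"
        using F(2) by (auto simp: unimodular_block_def)
      then have "x - f \<in> vec_mod.span B"
        using B(2) x FC C vec_mod.subspace_diff by blast
      then have "f + (x - f) \<in> vec_mod.span (F \<union> B)"
        using f(1) unfolding vec_mod.span_Un by blast
      then show "x \<in> vec_mod.span (F \<union> B)" by simp
    qed
  qed
  ultimately show ?thesis using code unfolding is_free_code_def by blast
qed

section \<open>LCD codes are free\<close>

theorem theorem3p15:
  fixes \<mm> :: "'a::comm_ring_1 set" and C :: "('a ^ 'n) set"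
  assumes "is_local_ring \<mm>" and "is_artinian TYPE('a)" and "is_frobenius \<mm>"
    and "is_code C" and "is_lcd C"
  shows "is_free_code C"
  using wf_proper_subcode[OF assms(2)] assms(4,5)
proof (induction C rule: wf_induct_rule)
  case (less C)
  show ?case
  proof (cases "C = {0}")
    case True
    have "{} \<subseteq> C \<and> vec_mod.independent {} \<and> vec_mod.span {} = C"
      unfolding True vec_mod.span_empty using vec_mod.independent_empty by blast
    then show ?thesis
      using less.prems(1) unfolding is_free_code_def by blast
  next
    case False
    then obtain v w where vw: "v \<in> C" "w \<in> C" "scalar_product v w \<notin> \<mm>"
      using lcd_code_unit_value[OF assms(1,2) less.prems] by blast
    obtain F where "F \<subseteq> {v, w}" and F': "F \<noteq> {}" "unimodular_block F"
      using unimodular_block_from_unit_value[OF assms(1) vw(3)] by blast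
    then have F: "F \<subseteq> C" using vw(1,2) by blast
    have code: "is_code (C \<inter> orthogonal_code F)"
      using less.prems(1) vec_mod.subspace_inter subspace_orthogonal_code
      unfolding is_code_def by blast
    obtain f where f: "f \<in> F" using F'(1) by blast
    then have "f \<noteq> 0"
      using F'(2) vec_mod.dependent_zero unfolding unimodular_block_def by blast
    then have "f \<notin> orthogonal_code F"
      using F'(2) vec_mod.span_base[OF f] unfolding unimodular_block_def by blast
    then have "C \<inter> orthogonal_code F \<subset> C" using f F by blast
    then have "is_free_code (C \<inter> orthogonal_code F)"
      using less.IH code less.prems lcd_orthogonal_complement[OF less.prems F F'(2)] by simp
    then show ?thesis
      by (rule free_of_free_orthogonal_complement[OF less.prems(1) F F'(2)])
  qed
qed

end
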